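(* Let $\mu_1$ be the $2$-dimensional complex Leibniz algebra with basis $e_1,e_2$ and only nonzero bracket $[e_1,e_1]=e_2$. Then the $4$-dimensional Leibniz algebra $\mu_1\oplus\mu_1$ has no metric deformations.
   Context: All algebras are over $\mathbb{C}$. A left (resp. right) Leibniz algebra is a vector space $\mathfrak{L}$ with a bilinear bracket satisfying $[x,[y,z]]=[[x,y],z]+[y,[x,z]]$ (resp. $[x,[y,z]]=[[x,y],z]-[[x,z],y]$); a Leibniz algebra is one or the other. A bilinear form $B$ on $\mathfrak{L}$ is invariant if $B([x,y],z)=B(x,[y,z])$ for all $x,y,z$. $\mathfrak{L}$ is metric if it has a non-degenerate symmetric invariant bilinear form. A (formal $1$-parameter, Leibniz) deformation of $(\mathfrak{L},\mu_0)$ is a Leibniz bracket $\mu_t=\mu_0+t\phi_1+t^2\phi_2+\cdots$ on $\mathfrak{L}\otimes\mathbb{C}[[t]]$, with $\phi_i$ bilinear maps $\mathfrak{L}\times\mathfrak{L}\to\mathfrak{L}$. Two deformations $\mu_t,\tilde\mu_t$ are equivalent if $\tilde\mu_t(x,y)=\Phi_t\mu_t(\Phi_t^{-1}x,\Phi_t^{-1}y)$ for some $\Phi_t=\mathrm{id}+t\,\Phi_1+t^2\Phi_2+\cdots$ with linear $\Phi_i$; a deformation equivalent to $\mu_0$ is trivial. A metric deformation is a non-trivial deformation $\mu_t$ that is a metric Leibniz algebra for $t\neq 0$ (for formal $t$: after extending scalars to $\mathbb{C}((t))$). *)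

theory Defs
  imports "HOL-Analysis.Analysis" "HOL-Computational_Algebra.Formal_Laurent_Series"
begin

text \<open>
  Algebras live on the free module 'a^'n over a commutative ring 'a: the case 'a = complex is an
  algebra over the complex numbers with a chosen basis, 'a = complex fps its extension of scalars
  to formal power series, and 'a = complex fls its extension to formal Laurent series.
\<close>

definition bilinear_bracket ::
  "('a::comm_ring_1^'n \<Rightarrow> 'a^'n \<Rightarrow> 'a^'n) \<Rightarrow> bool" where
  "bilinear_bracket br \<longleftrightarrow>
     (\<forall>x. module_hom vector_scalar_mult vector_scalar_mult (br x)) \<and>
     (\<forall>y. module_hom vector_scalar_mult vector_scalar_mult (\<lambda>x. br x y))"

definition left_leibniz ::
  "('a::comm_ring_1^'n \<Rightarrow> 'a^'n \<Rightarrow> 'a^'n) \<Rightarrow> bool" where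
  "left_leibniz br \<longleftrightarrow> bilinear_bracket br \<and>
     (\<forall>x y z. br x (br y z) = br (br x y) z + br y (br x z))"

definition right_leibniz ::
  "('a::comm_ring_1^'n \<Rightarrow> 'a^'n \<Rightarrow> 'a^'n) \<Rightarrow> bool" where
  "right_leibniz br \<longleftrightarrow> bilinear_bracket br \<and>
     (\<forall>x y z. br x (br y z) = br (br x y) z - br (br x z) y)"

definition leibniz_algebra ::
  "('a::comm_ring_1^'n \<Rightarrow> 'a^'n \<Rightarrow> 'a^'n) \<Rightarrow> bool" where
  "leibniz_algebra br \<longleftrightarrow> left_leibniz br \<or> right_leibniz br"

definition bilinear_form :: "('a::field^'n \<Rightarrow> 'a^'n \<Rightarrow> 'a) \<Rightarrow> bool" where
  "bilinear_form B \<longleftrightarrow>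
     (\<forall>x. module_hom vector_scalar_mult times (B x)) \<and>
     (\<forall>y. module_hom vector_scalar_mult times (\<lambda>x. B x y))"

definition symmetric_form :: "('a::field^'n \<Rightarrow> 'a^'n \<Rightarrow> 'a) \<Rightarrow> bool" where
  "symmetric_form B \<longleftrightarrow> (\<forall>x y. B x y = B y x)"

definition nondegenerate_form :: "('a::field^'n \<Rightarrow> 'a^'n \<Rightarrow> 'a) \<Rightarrow> bool" where
  "nondegenerate_form B \<longleftrightarrow>
     (\<forall>x. (\<forall>y. B x y = 0) \<longrightarrow> x = 0) \<and> (\<forall>y. (\<forall>x. B x y = 0) \<longrightarrow> y = 0)"

definition invariant_form ::
  "('a::field^'n \<Rightarrow> 'a^'n \<Rightarrow> 'a^'n) \<Rightarrow> ('a^'n \<Rightarrow> 'a^'n \<Rightarrow> 'a) \<Rightarrow> bool" where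
  "invariant_form br B \<longleftrightarrow> (\<forall>x y z. B (br x y) z = B x (br y z))"

definition metric_leibniz_algebra ::
  "('a::field^'n \<Rightarrow> 'a^'n \<Rightarrow> 'a^'n) \<Rightarrow> bool" where
  "metric_leibniz_algebra br \<longleftrightarrow> leibniz_algebra br \<and>
     (\<exists>B. bilinear_form B \<and> nondegenerate_form B \<and> symmetric_form B \<and> invariant_form br B)"

definition bracket_of ::
  "('n \<Rightarrow> 'n \<Rightarrow> 'n \<Rightarrow> 'a::comm_ring_1) \<Rightarrow> 'a^'n \<Rightarrow> 'a^'n \<Rightarrow> 'a^'n" where
  "bracket_of c x y = (\<chi> k. \<Sum>i\<in>UNIV. \<Sum>j\<in>UNIV. x $ i * y $ j * c i j k)"

text \<open>
  A family \<phi> of bilinear maps encodes the series \<phi> 0 + t \<phi> 1 + t^2 \<phi> 2 + ...; its structure constants with respect to the standard basis are formal power series in t.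
  Both brackets below are the bilinear extensions of this series, to power series and to
  Laurent series (see formal_bracket_const and laurent_bracket_of_formal_bracket).
\<close>

definition structure_series ::
  "(nat \<Rightarrow> complex^'n \<Rightarrow> complex^'n \<Rightarrow> complex^'n) \<Rightarrow> 'n \<Rightarrow> 'n \<Rightarrow> 'n \<Rightarrow> complex fps" where
  "structure_series \<phi> i j k = Abs_fps (\<lambda>m. \<phi> m (axis i 1) (axis j 1) $ k)"

definition formal_bracket ::
  "(nat \<Rightarrow> complex^'n \<Rightarrow> complex^'n \<Rightarrow> complex^'n)
     \<Rightarrow> complex fps^'n \<Rightarrow> complex fps^'n \<Rightarrow> complex fps^'n" where
  "formal_bracket \<phi> = bracket_of (structure_series \<phi>)"

definition laurent_bracket ::
  "(nat \<Rightarrow> complex^'n \<Rightarrow> complex^'n \<Rightarrow> complex^'n)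
     \<Rightarrow> complex fls^'n \<Rightarrow> complex fls^'n \<Rightarrow> complex fls^'n" where
  "laurent_bracket \<phi> = bracket_of (\<lambda>i j k. fps_to_fls (structure_series \<phi> i j k))"

text \<open>
  The power-series-linear extension of \<Phi> 0 + t \<Phi> 1 + t^2 \<Phi> 2 + ...; it is invertible
  when \<Phi> 0 is the identity (bij_formal_map), so that inv below is a genuine inverse.
\<close>

definition formal_map ::
  "(nat \<Rightarrow> complex^'n \<Rightarrow> complex^'n) \<Rightarrow> complex fps^'n \<Rightarrow> complex fps^'n" where
  "formal_map \<Phi> x = (\<chi> k. \<Sum>i\<in>UNIV. x $ i * Abs_fps (\<lambda>m. \<Phi> m (axis i 1) $ k))"

definition leibniz_deformation ::
  "(complex^'n \<Rightarrow> complex^'n \<Rightarrow> complex^'n)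
     \<Rightarrow> (nat \<Rightarrow> complex^'n \<Rightarrow> complex^'n \<Rightarrow> complex^'n) \<Rightarrow> bool" where
  "leibniz_deformation \<mu> \<phi> \<longleftrightarrow>
     \<phi> 0 = \<mu> \<and> (\<forall>m. bilinear_bracket (\<phi> m)) \<and> leibniz_algebra (formal_bracket \<phi>)"

definition equivalent_deformations ::
  "(nat \<Rightarrow> complex^'n \<Rightarrow> complex^'n \<Rightarrow> complex^'n)
     \<Rightarrow> (nat \<Rightarrow> complex^'n \<Rightarrow> complex^'n \<Rightarrow> complex^'n) \<Rightarrow> bool" where
  "equivalent_deformations \<phi> \<psi> \<longleftrightarrow>
     (\<exists>\<Phi>. \<Phi> 0 = id \<and>
        (\<forall>m. module_hom vector_scalar_mult vector_scalar_mult (\<Phi> m)) \<and>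
        (\<forall>x y. formal_bracket \<psi> x y =
           formal_map \<Phi> (formal_bracket \<phi> (inv (formal_map \<Phi>) x) (inv (formal_map \<Phi>) y))))"

definition constant_deformation ::
  "(complex^'n \<Rightarrow> complex^'n \<Rightarrow> complex^'n)
     \<Rightarrow> nat \<Rightarrow> complex^'n \<Rightarrow> complex^'n \<Rightarrow> complex^'n" where
  "constant_deformation \<mu> m = (if m = 0 then \<mu> else (\<lambda>x y. 0))"

definition trivial_deformation ::
  "(complex^'n \<Rightarrow> complex^'n \<Rightarrow> complex^'n)
     \<Rightarrow> (nat \<Rightarrow> complex^'n \<Rightarrow> complex^'n \<Rightarrow> complex^'n) \<Rightarrow> bool" where
  "trivial_deformation \<mu> \<phi> \<longleftrightarrow> equivalent_deformations (constant_deformation \<mu>) \<phi>"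

definition metric_deformation ::
  "(complex^'n \<Rightarrow> complex^'n \<Rightarrow> complex^'n)
     \<Rightarrow> (nat \<Rightarrow> complex^'n \<Rightarrow> complex^'n \<Rightarrow> complex^'n) \<Rightarrow> bool" where
  "metric_deformation \<mu> \<phi> \<longleftrightarrow>
     leibniz_deformation \<mu> \<phi> \<and> \<not> trivial_deformation \<mu> \<phi> \<and>
     metric_leibniz_algebra (laurent_bracket \<phi>)"

definition mu1 :: "complex^2 \<Rightarrow> complex^2 \<Rightarrow> complex^2" where
  "mu1 x y = (x $ 1 * y $ 1) *s axis 2 1"

definition direct_sum ::
  "('a::comm_ring_1^'m \<Rightarrow> 'a^'m \<Rightarrow> 'a^'m) \<Rightarrow> ('a^'n \<Rightarrow> 'a^'n \<Rightarrow> 'a^'n)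
     \<Rightarrow> 'a^('m + 'n) \<Rightarrow> 'a^('m + 'n) \<Rightarrow> 'a^('m + 'n)" where
  "direct_sum br br' x y =
     (\<chi> k. case k of
        Inl i \<Rightarrow> br (\<chi> a. x $ Inl a) (\<chi> a. y $ Inl a) $ i
      | Inr j \<Rightarrow> br' (\<chi> b. x $ Inr b) (\<chi> b. y $ Inr b) $ j)"

lemma module_vec: "module (vector_scalar_mult :: 'a::comm_ring_1 \<Rightarrow> 'a^'n \<Rightarrow> 'a^'n)"
  by unfold_locales (simp_all add: vec_eq_iff vector_scalar_mult_def algebra_simps)

lemma module_hom_vecI:
  fixes f :: "'a::comm_ring_1^'m \<Rightarrow> 'a^'n"
  assumes "\<And>x y. f (x + y) = f x + f y" "\<And>c x. f (c *s x) = c *s f x"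
  shows "module_hom vector_scalar_mult vector_scalar_mult f"
  using assms by (intro module_hom.intro module_vec module_hom_axioms.intro)

lemma bilinear_bracket_mu1: "bilinear_bracket mu1"
  unfolding bilinear_bracket_def
  by (intro allI conjI module_hom_vecI; simp add: mu1_def vec_eq_iff algebra_simps)

lemma mu1_basis:
  "mu1 (axis 1 1) (axis 1 1) = axis 2 1"
  "mu1 (axis 1 1) (axis 2 1) = 0" "mu1 (axis 2 1) (axis 1 1) = 0"
  "mu1 (axis 2 1) (axis 2 1) = 0"
  by (simp_all add: mu1_def axis_def vec_eq_iff)

lemma leibniz_algebra_mu1_mu1:
  "left_leibniz (direct_sum mu1 mu1)" "right_leibniz (direct_sum mu1 mu1)"
proof -
  have bil: "bilinear_bracket (direct_sum mu1 mu1)"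
    unfolding bilinear_bracket_def
    by (intro allI conjI module_hom_vecI;
        simp add: direct_sum_def mu1_def vec_eq_iff algebra_simps split: sum.split)
  have "direct_sum mu1 mu1 x (direct_sum mu1 mu1 y z) = 0"
    "direct_sum mu1 mu1 (direct_sum mu1 mu1 x y) z = 0" for x y z
    by (simp_all add: direct_sum_def mu1_def vec_eq_iff axis_def split: sum.split)
  then show "left_leibniz (direct_sum mu1 mu1)" "right_leibniz (direct_sum mu1 mu1)"
    using bil by (simp_all add: left_leibniz_def right_leibniz_def)
qed

lemma formal_bracket_const:
  fixes x y :: "complex^'n"
  assumes "\<And>m. bilinear_bracket (\<phi> m)"
  shows "fps_nth (formal_bracket \<phi> (\<chi> i. fps_const (x $ i)) (\<chi> j. fps_const (y $ j)) $ k) m =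
         \<phi> m x y $ k"
proof -
  have l: "module_hom vector_scalar_mult vector_scalar_mult (\<phi> m v)" for v
    using assms by (simp add: bilinear_bracket_def)
  have r: "module_hom vector_scalar_mult vector_scalar_mult (\<lambda>u. \<phi> m u w)" for w
    using assms by (simp add: bilinear_bracket_def)
  have "\<phi> m x y = \<phi> m (\<Sum>i\<in>UNIV. x $ i *s axis i 1) (\<Sum>j\<in>UNIV. y $ j *s axis j 1)"
    by (simp add: basis_expansion)
  also have "\<dots> = (\<Sum>i\<in>UNIV. \<Sum>j\<in>UNIV. x $ i *s (y $ j *s \<phi> m (axis i 1) (axis j 1)))"
    by (simp add: module_hom.sum[OF l] module_hom.scale[OF l] module_hom.sum[OF r]
        module_hom.scale[OF r] module.scale_sum_right[OF module_vec])
       (subst sum.swap, simp add: mult.commute)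
  finally show ?thesis
    by (simp add: formal_bracket_def bracket_of_def structure_series_def fps_sum_nth mult.assoc
        flip: fps_const_mult)
qed

lemma laurent_bracket_of_formal_bracket:
  fixes x y :: "complex fps^'n"
  shows "laurent_bracket \<phi> (\<chi> i. fps_to_fls (x $ i)) (\<chi> j. fps_to_fls (y $ j)) =
   (\<chi> k. fps_to_fls (formal_bracket \<phi> x y $ k))"
proof -
  have "fps_to_fls (sum f A) = (\<Sum>i\<in>A. fps_to_fls (f i))"
    for f :: "'n \<Rightarrow> complex fps" and A
    by (induction A rule: infinite_finite_induct) simp_all
  then show ?thesis
    by (simp add: laurent_bracket_def formal_bracket_def bracket_of_def fls_times_fps_to_fls)
qed

lemma formal_map_nth:
  fixes x :: "complex fps^'n"
  assumes "\<Phi> 0 = id"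
  shows "fps_nth (formal_map \<Phi> x $ k) m =
    fps_nth (x $ k) m + (\<Sum>l<m. \<Sum>i\<in>UNIV. fps_nth (x $ i) l * \<Phi> (m - l) (axis i 1) $ k)"
proof -
  have "fps_nth (formal_map \<Phi> x $ k) m =
      (\<Sum>i\<in>UNIV. \<Sum>l\<le>m. fps_nth (x $ i) l * \<Phi> (m - l) (axis i 1) $ k)"
    by (simp add: formal_map_def fps_sum_nth fps_mult_nth atLeast0AtMost)
  also have "\<dots> = (\<Sum>l\<le>m. \<Sum>i\<in>UNIV. fps_nth (x $ i) l * \<Phi> (m - l) (axis i 1) $ k)"
    by (rule sum.swap)
  also have "\<dots> = (\<Sum>i\<in>UNIV. fps_nth (x $ i) m * axis i 1 $ k)
      + (\<Sum>l<m. \<Sum>i\<in>UNIV. fps_nth (x $ i) l * \<Phi> (m - l) (axis i 1) $ k)"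
    by (simp add: assms add.commute flip: lessThan_Suc_atMost)
  also have "(\<Sum>i\<in>UNIV. fps_nth (x $ i) m * axis i 1 $ k) = fps_nth (x $ k) m"
    by (simp add: axis_def if_distrib cong: if_cong)
  finally show ?thesis .
qed

fun formal_preimage ::
  "(nat \<Rightarrow> complex^'n \<Rightarrow> complex^'n) \<Rightarrow> complex fps^'n \<Rightarrow> nat \<Rightarrow> complex^'n" where
  "formal_preimage \<Phi> y m = (\<chi> k. fps_nth (y $ k) m -
     (\<Sum>l\<in>set [0..<m]. \<Sum>i\<in>UNIV. formal_preimage \<Phi> y l $ i * \<Phi> (m - l) (axis i 1) $ k))"

declare formal_preimage.simps [simp del]

lemma bij_formal_map:
  fixes \<Phi> :: "nat \<Rightarrow> complex^'n \<Rightarrow> complex^'n"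
  assumes id: "\<Phi> 0 = id"
  shows "bij (formal_map \<Phi>)"
proof (rule bijI)
  show "inj (formal_map \<Phi>)"
  proof (rule injI)
    fix x y :: "complex fps^'n"
    assume eq: "formal_map \<Phi> x = formal_map \<Phi> y"
    have "\<forall>k. fps_nth (x $ k) m = fps_nth (y $ k) m" for m
    proof (induction m rule: less_induct)
      case (less m)
      show ?case
      proof
        fix k
        have "fps_nth (formal_map \<Phi> x $ k) m = fps_nth (formal_map \<Phi> y $ k) m"
          by (simp add: eq)
        then show "fps_nth (x $ k) m = fps_nth (y $ k) m"
          using less by (simp add: formal_map_nth[of \<Phi>, OF id])
      qed
    qed
    then show "x = y" by (simp add: vec_eq_iff fps_eq_iff)
  qed
  show "surj (formal_map \<Phi>)"
  proof (rule surjI)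
    fix y :: "complex fps^'n"
    show "formal_map \<Phi> (\<chi> k. Abs_fps (\<lambda>m. formal_preimage \<Phi> y m $ k)) = y"
      by (simp add: vec_eq_iff fps_eq_iff formal_map_nth[of \<Phi>, OF id])
         (subst formal_preimage.simps, simp add: atLeast0LessThan)
  qed
qed

end

theory Submission
  imports Defs
begin

text \<open>
  A metric of the Laurent extension restricts to a non-degenerate form on the lattice of power
  series vectors. With the Leibniz identity, invariance makes all squares [x,x] central on both
  sides. Let e, f be the standard generators; modulo t the vectors e, f, [e,e], [f,f] are the
  standard basis, so they are a basis over the power series. Pairing [e,f] - [f,e] with this basis
  gives zero, so [e,f] = [f,e]; by polarisation [e,f] is central too, which forces
  [e,f] = r [e,e] + s [f,f] with r, s divisible by t. If \<sigma> = 1 + \<sigma>^2 r s, then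
  E = e - \<sigma> s f and F = f - \<sigma> r e satisfy [E,F] = [F,E] = 0, and the basis
  E, [E,E], F, [F,F] is an equivalence with the constant deformation.
\<close>

unbundle no Formal_Power_Series.fps_syntax

lemma sum_axis_mult:
  fixes f :: "'n::finite \<Rightarrow> 'a::semiring_1"
  shows "(\<Sum>i\<in>UNIV. axis a 1 $ i * f i) = f a" "(\<Sum>i\<in>UNIV. f i * axis i 1 $ a) = f a"
proof -
  have "axis a 1 $ i * f i = (if i = a then f i else 0)"
    "f i * axis i 1 $ a = (if i = a then f i else 0)" for i
    by (auto simp: axis_def)
  then show "(\<Sum>i\<in>UNIV. axis a 1 $ i * f i) = f a" "(\<Sum>i\<in>UNIV. f i * axis i 1 $ a) = f a"
    by simp_all
qed

section \<open>Bilinear brackets and invariant symmetric forms\<close>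

context
  fixes br :: "'a::comm_ring_1^'n \<Rightarrow> 'a^'n \<Rightarrow> 'a^'n"
  assumes bil: "bilinear_bracket br"
begin

lemma bracket_hom:
  "module_hom vector_scalar_mult vector_scalar_mult (br x)"
  "module_hom vector_scalar_mult vector_scalar_mult (\<lambda>x. br x y)"
  using bil by (auto simp: bilinear_bracket_def)

lemmas bracket_simps =
  module_hom.add[OF bracket_hom(1)] module_hom.add[OF bracket_hom(2)]
  module_hom.scale[OF bracket_hom(1)] module_hom.scale[OF bracket_hom(2)]
  module_hom.zero[OF bracket_hom(1)] module_hom.zero[OF bracket_hom(2)]

lemma bracket_sum_sum:
  "br (\<Sum>i\<in>A. x i *s v i) (\<Sum>j\<in>A'. y j *s w j) =
    (\<Sum>i\<in>A. \<Sum>j\<in>A'. (x i * y j) *s br (v i) (w j))"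
  by (simp add: module_hom.sum[OF bracket_hom(1)] module_hom.sum[OF bracket_hom(2)] bracket_simps
      module.scale_sum_right[OF module_vec])
    (subst sum.swap, simp add: mult.commute)

text \<open>The Leibniz identity with two equal arguments kills [[x,x],y] in the left case and
  [y,[x,x]] in the right case; invariance and non-degeneracy carry this over to the other
  side.\<close>

lemma squares_central:
  fixes b :: "'a^'n \<Rightarrow> 'a^'n \<Rightarrow> 'b::zero"
  assumes "leibniz_algebra br"
    and sym: "\<And>x y. b x y = b y x" and inv: "\<And>x y z. b (br x y) z = b x (br y z)"
    and zero: "\<And>x. b 0 x = 0" and nondeg: "\<And>x. (\<And>y. b x y = 0) \<Longrightarrow> x = 0"
  shows "br (br x x) y = 0" "br y (br x x) = 0"
proof -
  \<comment> \<open>b([[x,x],y], z) = b([x,x], [y,z]) = b([y,z], [x,x]) = b(y, [z,[x,x]]) =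
    0.\<close>
  have left_if_right: "br (br x x) y = 0" if "\<And>y. br y (br x x) = 0" for x y
    by (rule nondeg) (metis inv sym zero that)
  have right_if_left: "br y (br x x) = 0" if "\<And>y. br (br x x) y = 0" for x y
    by (rule nondeg) (metis inv sym zero that)
  from assms(1) consider "left_leibniz br" | "right_leibniz br"
    by (auto simp: leibniz_algebra_def)
  then have "(\<forall>x y. br (br x x) y = 0) \<and> (\<forall>x y. br y (br x x) = 0)"
  proof cases
    case 1
    then have "br (br x x) y = 0" for x y
      unfolding left_leibniz_def by (metis add_cancel_left_left)
    then show ?thesis using right_if_left by blast
  next
    case 2
    then have "br y (br x x) = 0" for x y
      unfolding right_leibniz_def by (metis diff_self)
    then show ?thesis using left_if_right by blast
  qed
  then show "br (br x x) y = 0" "br y (br x x) = 0" by auto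
qed

text \<open>The difference of the two brackets is orthogonal to a spanning set. Vectors and values
  of \<open>b\<close> may have different scalars, so \<open>scale\<close> only asks that
  orthogonality survive scaling.\<close>

lemma bracket_commute_on_generators:
  fixes b :: "'a^'n \<Rightarrow> 'a^'n \<Rightarrow> 'b::ab_group_add"
  assumes sym: "\<And>x y. b x y = b y x" and inv: "\<And>x y z. b (br x y) z = b x (br y z)"
    and add: "\<And>x y z. b (x + y) z = b x z + b y z"
    and scale: "\<And>c x y. b x y = 0 \<Longrightarrow> b (c *s x) y = 0"
    and nondeg: "\<And>x. (\<And>y. b x y = 0) \<Longrightarrow> x = 0"
    and central: "\<And>x y. br y (br x x) = 0"
    and span: "\<And>z. \<exists>p q r s. z = p *s x + q *s y + r *s br x x + s *s br y y"
  shows "br x y = br y x"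
proof -
  have zero: "b 0 z = 0" for z
    using add[of 0 0 z] by simp
  have diff: "b (u - w) z = b u z - b w z" for u w z
    using add[of "u - w" w z] by simp
  define d where "d = br x y - br y x"
  \<comment> \<open>For x: b([x,y],x) = b(x,[y,x]) = b([y,x],x). For [x,x]: b([x,y],[x,x]) =
    b(x,[y,[x,x]]) = 0, and likewise for [y,x].\<close>
  have "b x d = 0" "b y d = 0" "b (br x x) d = 0" "b (br y y) d = 0"
    unfolding d_def by (simp_all only: sym[of _ "br x y - br y x"] diff)
      (metis inv sym diff_self, metis inv sym diff_self,
        metis inv sym zero central diff_self, metis inv sym zero central diff_self)
  then have "b z d = 0" for z
    using span[of z] by (auto simp: add scale)
  then have "d = 0" by (intro nondeg) (simp add: sym)
  then show ?thesis by (simp add: d_def)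
qed

end

section \<open>Equivalences given by a frame\<close>

text \<open>The coefficient at t^m of the matrix with columns \<open>v i\<close>, in the shape that
  \<open>formal_map\<close> expects.\<close>

definition frame_series ::
    "('n \<Rightarrow> complex fps^'n) \<Rightarrow> nat \<Rightarrow> complex^'n \<Rightarrow> complex^'n" where
  "frame_series v m x = (\<chi> k. \<Sum>i\<in>UNIV. x $ i * fps_nth (v i $ k) m)"

lemma formal_map_frame_series:
  "formal_map (frame_series v) x = (\<Sum>i\<in>UNIV. x $ i *s v i)"
  by (simp add: formal_map_def frame_series_def vec_eq_iff sum_axis_mult fps_nth_inverse)

lemma frame_series_0:
  assumes "\<And>i k. fps_nth (v i $ k) 0 = axis i 1 $ k"
  shows "frame_series v 0 = id"
  by (simp add: fun_eq_iff frame_series_def assms vec_eq_iff sum_axis_mult)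

lemma module_hom_frame_series:
  "module_hom vector_scalar_mult vector_scalar_mult (frame_series v m)"
  by (intro module_hom_vecI)
    (simp_all add: frame_series_def vec_eq_iff algebra_simps sum.distrib sum_distrib_left)

text \<open>The power-series-linear map sending the standard basis to \<open>v\<close> is the
  identity modulo t, hence invertible. It carries one bracket to the other because their structure
  constants agree.\<close>

lemma equivalent_deformationsI:
  fixes v :: "'n \<Rightarrow> complex fps^'n"
  assumes bil: "bilinear_bracket (formal_bracket \<psi>)"
    and v0: "\<And>i k. fps_nth (v i $ k) 0 = axis i 1 $ k"
    and v: "\<And>i j. formal_bracket \<psi> (v i) (v j) = (\<Sum>k\<in>UNIV. structure_series \<phi> i j k *s v k)"
  shows "equivalent_deformations \<phi> \<psi>"
  unfolding equivalent_deformations_def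
proof (intro exI[of _ "frame_series v"] conjI allI frame_series_0 v0 module_hom_frame_series)
  fix x y
  let ?T = "formal_map (frame_series v)"
  have "bij ?T" by (intro bij_formal_map frame_series_0 v0)
  then have T: "?T (inv ?T z) = z" for z by (simp add: bij_is_surj surj_f_inv_f)
  have "formal_bracket \<psi> (?T x) (?T y) = ?T (formal_bracket \<phi> x y)" for x y
  proof -
    have "formal_bracket \<psi> (?T x) (?T y)
        = (\<Sum>i\<in>UNIV. \<Sum>j\<in>UNIV. \<Sum>k\<in>UNIV. (x $ i * y $ j * structure_series \<phi> i j k) *s v k)"
      by (simp add: formal_map_frame_series bracket_sum_sum[OF bil] v
          module.scale_sum_right[OF module_vec])
    also have "\<dots> = (\<Sum>i\<in>UNIV. \<Sum>k\<in>UNIV. \<Sum>j\<in>UNIV. (x $ i * y $ j * structure_series \<phi> i j k) *s v k)"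
      by (intro sum.cong refl sum.swap)
    also have "\<dots> = (\<Sum>k\<in>UNIV. \<Sum>i\<in>UNIV. \<Sum>j\<in>UNIV. (x $ i * y $ j * structure_series \<phi> i j k) *s v k)"
      by (rule sum.swap)
    also have "\<dots> = ?T (formal_bracket \<phi> x y)"
      by (simp add: formal_map_frame_series formal_bracket_def bracket_of_def
          module.scale_sum_left[OF module_vec])
    finally show ?thesis .
  qed
  from this[of "inv ?T x" "inv ?T y"]
  show "formal_bracket \<psi> x y = ?T (formal_bracket \<phi> (inv ?T x) (inv ?T y))"
    by (simp add: T)
qed

text \<open>The Catalan generating function at \<open>c\<close>, written as 2/(1 + sqrt(1 - 4c)):
  this denominator has constant term 2, whereas (1 - sqrt(1 - 4c))/(2c) would divide by a
  non-unit.\<close>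

lemma fps_catalan_equation:
  fixes c :: "complex fps"
  assumes "fps_nth c 0 = 0"
  obtains s where "s = 1 + s^2 * c"
proof -
  \<comment> \<open>The radicand has constant term 1, so the identity supplies its root and r has
    constant term 1.\<close>
  define r where "r = fps_radical (\<lambda>n x. x) 2 (1 - 4 * c)"
  have r: "r^2 = 1 - 4 * c" "fps_nth r 0 = 1"
    using power_radical[of "1 - 4 * c" "\<lambda>n x. x" 1] assms
    by (simp_all add: r_def numeral_2_eq_2)
  define s where "s = 2 * inverse (1 + r)"
  have s: "s * (1 + r) = 2"
    unfolding s_def using r(2) by (simp add: mult.assoc inverse_mult_eq_1)
  \<comment> \<open>The square clears the denominator of s; the factor 4 lets c enter only through
    4c = 1 - r^2.\<close>
  have "(1 + s^2 * c - s) * (1 + r)^2 * 4 = 0"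
  proof -
    have "4 * c = 1 - r^2" using r(1) by simp
    then show ?thesis using s by algebra
  qed
  moreover have "1 + r \<noteq> 0" using s by auto
  ultimately have "s = 1 + s^2 * c" by simp
  then show ?thesis by (rule that)
qed

section \<open>Descent from Laurent series to power series\<close>

text \<open>The coefficientwise embedding respects the brackets, so the metric pulls back. Its image
  contains the standard basis of the Laurent space, which keeps the pullback non-degenerate.\<close>

lemma metric_lattice_form:
  fixes \<phi> :: "nat \<Rightarrow> complex^'n \<Rightarrow> complex^'n \<Rightarrow> complex^'n"
  assumes "metric_leibniz_algebra (laurent_bracket \<phi>)"
  obtains b :: "complex fps^'n \<Rightarrow> complex fps^'n \<Rightarrow> complex fls" where
    "\<And>x y. b x y = b y x"
    "\<And>x y z. b (formal_bracket \<phi> x y) z = b x (formal_bracket \<phi> y z)"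
    "\<And>x y z. b (x + y) z = b x z + b y z"
    "\<And>c x y. b (c *s x) y = fps_to_fls c * b x y"
    "\<And>x. (\<And>y. b x y = 0) \<Longrightarrow> x = 0"
proof -
  obtain B where B: "bilinear_form B" "nondegenerate_form B" "symmetric_form B"
      "invariant_form (laurent_bracket \<phi>) B"
    using assms by (auto simp: metric_leibniz_algebra_def)
  define \<iota> :: "complex fps^'n \<Rightarrow> complex fls^'n" where "\<iota> x = (\<chi> i. fps_to_fls (x $ i))" for x
  have br: "\<iota> (formal_bracket \<phi> x y) = laurent_bracket \<phi> (\<iota> x) (\<iota> y)" for x y
    by (simp add: \<iota>_def laurent_bracket_of_formal_bracket)
  have add: "\<iota> (x + y) = \<iota> x + \<iota> y" and scale: "\<iota> (c *s x) = fps_to_fls c *s \<iota> x" for x y c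
    by (simp_all add: \<iota>_def vec_eq_iff fls_times_fps_to_fls)
  have r: "module_hom vector_scalar_mult times (B x)" for x
    using B(1) by (simp add: bilinear_form_def)
  have l: "module_hom vector_scalar_mult times (\<lambda>x. B x y)" for y
    using B(1) by (simp add: bilinear_form_def)
  have nondeg: "x = 0" if "\<And>y. B (\<iota> x) (\<iota> y) = 0" for x
  proof -
    have "\<iota> (axis i 1) = axis i 1" for i
      by (simp add: \<iota>_def axis_def vec_eq_iff)
    then have "B (\<iota> x) (axis i 1) = 0" for i using that by metis
    then have "B (\<iota> x) (\<Sum>i\<in>UNIV. z $ i *s axis i 1) = 0" for z
      by (simp add: module_hom.sum[OF r] module_hom.scale[OF r])
    then have "\<iota> x = 0" using B(2) by (simp add: basis_expansion nondegenerate_form_def)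
    then show ?thesis by (simp add: \<iota>_def vec_eq_iff)
  qed
  show thesis
  proof (rule that[of "\<lambda>x y. B (\<iota> x) (\<iota> y)"])
    show "B (\<iota> x) (\<iota> y) = B (\<iota> y) (\<iota> x)" for x y
      using B(3) by (simp add: symmetric_form_def)
    show "B (\<iota> (formal_bracket \<phi> x y)) (\<iota> z) = B (\<iota> x) (\<iota> (formal_bracket \<phi> y z))" for x y z
      using B(4) by (simp add: br invariant_form_def)
  qed (auto simp: add scale module_hom.add[OF l] module_hom.scale[OF l] nondeg)
qed

text \<open>Taking constant terms is a ring homomorphism, so modulo t only \<open>\<phi> 0\<close>
  remains.\<close>

lemma formal_bracket_constant_term:
  fixes x y :: "complex fps^'n"
  assumes "\<And>m. bilinear_bracket (\<phi> m)"
  shows "fps_nth (formal_bracket \<phi> x y $ k) 0 =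
    \<phi> 0 (\<chi> i. fps_nth (x $ i) 0) (\<chi> i. fps_nth (y $ i) 0) $ k"
  by (subst formal_bracket_const[OF assms, symmetric])
    (simp add: formal_bracket_def bracket_of_def fps_sum_nth)

section \<open>Coordinates on the four-dimensional sum\<close>

lemma direct_sum_mu1_nth:
  "direct_sum mu1 mu1 x y $ Inl 1 = 0" "direct_sum mu1 mu1 x y $ Inr 1 = 0"
  "direct_sum mu1 mu1 x y $ Inl 2 = x $ Inl 1 * y $ Inl 1"
  "direct_sum mu1 mu1 x y $ Inr 2 = x $ Inr 1 * y $ Inr 1"
  by (simp_all add: direct_sum_def mu1_def axis_def)

lemma sum_2_plus_2:
  "(\<Sum>i\<in>(UNIV :: (2 + 2) set). f i) = f (Inl 1) + f (Inl 2) + f (Inr 1) + f (Inr 2)"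
  by (simp add: sum_2 sum.Plus add.assoc flip: UNIV_Plus_UNIV)

lemma forall_2_plus_2:
  "(\<forall>i :: 2 + 2. P i) \<longleftrightarrow> P (Inl 1) \<and> P (Inl 2) \<and> P (Inr 1) \<and> P (Inr 2)"
  by (auto simp: split_sum_all forall_2)

text \<open>The slots follow the basis e_1, e_2 of each copy of \<open>mu1\<close>; below,
  \<open>Inl 2\<close> and \<open>Inr 2\<close> receive the squares of the entries at
  \<open>Inl 1\<close> and \<open>Inr 1\<close>, as e_2 = [e_1,e_1].\<close>

definition frame4 :: "'b \<Rightarrow> 'b \<Rightarrow> 'b \<Rightarrow> 'b \<Rightarrow> 2 + 2 \<Rightarrow> 'b" where
  "frame4 x y z w = case_sum (\<lambda>i. if i = 1 then x else y) (\<lambda>i. if i = 1 then z else w)"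

lemma frame4_simps [simp]:
  "frame4 x y z w (Inl 1) = x" "frame4 x y z w (Inl 2) = y"
  "frame4 x y z w (Inr 1) = z" "frame4 x y z w (Inr 2) = w"
  by (simp_all add: frame4_def)

section \<open>Straightening the deformed bracket\<close>

lemma metric_deformation_trivial:
  assumes deform: "leibniz_deformation (direct_sum mu1 mu1) \<phi>"
    and metric: "metric_leibniz_algebra (laurent_bracket \<phi>)"
  shows "trivial_deformation (direct_sum mu1 mu1) \<phi>"
proof -
  let ?br = "formal_bracket \<phi>"
  have \<phi>: "\<phi> 0 = direct_sum mu1 mu1" "\<And>m. bilinear_bracket (\<phi> m)"
    and leib: "leibniz_algebra ?br"
    using deform by (auto simp: leibniz_deformation_def)
  then have bil: "bilinear_bracket ?br"
    by (auto simp: leibniz_algebra_def left_leibniz_def right_leibniz_def)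
  note br_simps = bracket_simps[OF bil]
  obtain b :: "complex fps^(2 + 2) \<Rightarrow> complex fps^(2 + 2) \<Rightarrow> complex fls" where
    sym: "\<And>x y. b x y = b y x"
    and inv: "\<And>x y z. b (?br x y) z = b x (?br y z)"
    and add: "\<And>x y z. b (x + y) z = b x z + b y z"
    and scale: "\<And>c x y. b (c *s x) y = fps_to_fls c * b x y"
    and nondeg: "\<And>x. (\<And>y. b x y = 0) \<Longrightarrow> x = 0"
    using metric_lattice_form[OF metric] by blast
  have "b 0 x = 0" for x using add[of 0 0 x] by simp
  note central = squares_central[OF bil leib sym inv this nondeg]
  note ct = formal_bracket_constant_term[of \<phi>, OF \<phi>(2), unfolded \<phi>(1)]
  \<comment> \<open>Modulo t the squares are those of the undeformed algebra. This serves e, f first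
    and E, F later.\<close>
  have frame: "fps_nth (frame4 x (?br x x) y (?br y y) i $ k) 0 = axis i 1 $ k"
    if "\<And>k. fps_nth (x $ k) 0 = axis (Inl 1) 1 $ k" "\<And>k. fps_nth (y $ k) 0 = axis (Inr 1) 1 $ k"
    for x y i k
  proof -
    have "\<forall>i k. fps_nth (frame4 x (?br x x) y (?br y y) i $ k) 0 = axis i 1 $ k"
      unfolding forall_2_plus_2 by (simp add: that ct direct_sum_mu1_nth) (simp add: axis_def)
    then show ?thesis by blast
  qed

  define e f :: "complex fps^(2 + 2)" where "e = axis (Inl 1) 1" and "f = axis (Inr 1) 1"
  have e0: "fps_nth (e $ k) 0 = axis (Inl 1) 1 $ k" and f0: "fps_nth (f $ k) 0 = axis (Inr 1) 1 $ k" for k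
    by (simp_all add: e_def f_def axis_def)
  have span: "\<exists>p q r s. z = p *s e + q *s f + r *s ?br e e + s *s ?br f f" for z
  proof -
    have "surj (formal_map (frame_series (frame4 e (?br e e) f (?br f f))))"
      by (intro bij_is_surj bij_formal_map frame_series_0 frame e0 f0)
    then obtain x where "z = formal_map (frame_series (frame4 e (?br e e) f (?br f f))) x"
      by (rule surjE)
    then have "z = x $ Inl 1 *s e + x $ Inr 1 *s f + x $ Inl 2 *s ?br e e + x $ Inr 2 *s ?br f f"
      by (simp add: formal_map_frame_series sum_2_plus_2)
    then show ?thesis by blast
  qed
  have comm: "?br f e = ?br e f"
    by (rule bracket_commute_on_generators[OF bil sym inv add _ nondeg central(2) span, symmetric])
      (simp_all add: scale)
  \<comment> \<open>Expanding the square of e + f leaves twice [[e,f],z] by commutativity, and 2 is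
    invertible.\<close>
  have ef_central: "?br (?br e f) z = 0" for z
  proof -
    have "?br (?br (e + f) (e + f)) z = 0" by (rule central)
    then have "?br (?br e f) z + ?br (?br f e) z = 0"
      by (simp add: br_simps central add.commute)
    then show ?thesis by (simp add: vec_eq_iff comm)
  qed
  obtain p q r s where pqrs: "?br e f = p *s e + q *s f + r *s ?br e e + s *s ?br f f"
    using span by blast
  have pq: "p = 0" "q = 0"
  proof -
    \<comment> \<open>Bracketing [e,f] with e and f gives p[e,e] + q[e,f] = 0 and p[e,f] + q[f,f] =
      0. Taking one coordinate of each yields a system with determinant D, which is 1 modulo
      t.\<close>
    define D where "D = ?br e e $ Inl 2 * ?br f f $ Inr 2 - ?br e f $ Inl 2 * ?br e f $ Inr 2"
    have "p *s ?br e e + q *s ?br e f = 0" "p *s ?br e f + q *s ?br f f = 0"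
      using ef_central[of e] ef_central[of f] by (simp_all add: pqrs br_simps central comm)
    then have "p * ?br e e $ Inl 2 + q * ?br e f $ Inl 2 = 0" "p * ?br e f $ Inr 2 + q * ?br f f $ Inr 2 = 0"
      unfolding vec_eq_iff by auto
    then have "p * D = 0" "q * D = 0"
      unfolding D_def by algebra+
    moreover have "fps_nth D 0 = 1"
      unfolding D_def by (simp add: ct direct_sum_mu1_nth e0 f0) (simp add: axis_def)
    then have "D \<noteq> 0" by auto
    ultimately show "p = 0" "q = 0" by auto
  qed
  have ef: "?br e f = r *s ?br e e + s *s ?br f f"
    using pqrs by (simp add: pq)
  \<comment> \<open>e and f lie in different summands, so [e,f] vanishes modulo t, while [e,e] and
    [f,f] reduce to basis vectors.\<close>
  have rs: "fps_nth r 0 = 0" "fps_nth s 0 = 0"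
  proof -
    have "fps_nth (?br e f $ k) 0 = fps_nth ((r *s ?br e e + s *s ?br f f) $ k) 0" for k
      by (simp add: ef)
    from this[of "Inl 2"] this[of "Inr 2"] show "fps_nth r 0 = 0" "fps_nth s 0 = 0"
      by (simp_all add: ct direct_sum_mu1_nth e0 f0) (simp_all add: axis_def)
  qed
  \<comment> \<open>For E and F below, [E,F] = (1 + \<sigma>^2 rs - \<sigma>) [e,f];
    \<open>\<sigma>\<close> is chosen to make this factor vanish.\<close>
  obtain \<sigma> where \<sigma>: "\<sigma> = 1 + \<sigma>\<^sup>2 * (r * s)"
    using fps_catalan_equation[of "r * s"] rs by auto
  define E F where "E = e - (\<sigma> * s) *s f" and "F = f - (\<sigma> * r) *s e"
  \<comment> \<open>Sums replace differences because \<open>bracket_simps\<close> has no rule for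
    subtraction.\<close>
  have E: "E = e + (- \<sigma> * s) *s f" and F: "F = f + (- \<sigma> * r) *s e"
    by (simp_all add: E_def F_def vec_eq_iff)
  have EF: "?br E F = 0"
  proof -
    have "?br E F = ?br e f - (\<sigma> * r) *s ?br e e - (\<sigma> * s) *s ?br f f + (\<sigma>\<^sup>2 * (r * s)) *s ?br e f"
      by (simp add: E F br_simps comm) (simp add: vec_eq_iff algebra_simps power2_eq_square)
    also have "\<dots> = (1 + \<sigma>\<^sup>2 * (r * s)) *s ?br e f - \<sigma> *s (r *s ?br e e + s *s ?br f f)"
      by (simp add: vec_eq_iff algebra_simps)
    also have "\<dots> = 0"
      by (simp flip: \<sigma> ef)
    finally show ?thesis .
  qed
  have FE: "?br F E = 0"
    using EF by (simp add: E F br_simps comm algebra_simps)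
  \<comment> \<open>As r and s vanish modulo t, E and F agree there with e and f.\<close>
  have frame_EF: "fps_nth (frame4 E (?br E E) F (?br F F) i $ k) 0 = axis i 1 $ k" for i k
    by (rule frame) (simp_all add: E F e0 f0 rs)
  have "equivalent_deformations (constant_deformation (direct_sum mu1 mu1)) \<phi>"
  proof (rule equivalent_deformationsI[OF bil frame_EF])
    have [simp]: "structure_series (constant_deformation (direct_sum mu1 mu1)) i j k =
        fps_const (direct_sum mu1 mu1 (axis i 1) (axis j 1) $ k)" for i j k :: "2 + 2"
      by (simp add: structure_series_def constant_deformation_def fps_eq_iff)
    \<comment> \<open>Squares are central and both mixed brackets of E and F vanish, so only [E,E]
      and [F,F] survive, and these are frame vectors themselves.\<close>
    have "\<forall>i j. ?br (frame4 E (?br E E) F (?br F F) i) (frame4 E (?br E E) F (?br F F) j) =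
       (\<Sum>k\<in>UNIV. structure_series (constant_deformation (direct_sum mu1 mu1)) i j k
          *s frame4 E (?br E E) F (?br F F) k)"
      unfolding forall_2_plus_2 sum_2_plus_2
      by (simp add: central EF FE direct_sum_mu1_nth) (simp add: axis_def)
    then show "?br (frame4 E (?br E E) F (?br F F) i) (frame4 E (?br E E) F (?br F F) j) =
       (\<Sum>k\<in>UNIV. structure_series (constant_deformation (direct_sum mu1 mu1)) i j k
          *s frame4 E (?br E E) F (?br F F) k)" for i j
      by blast
  qed
  then show ?thesis by (simp add: trivial_deformation_def)
qed

theorem theorem4p6:
  shows "\<not> (\<exists>\<phi>. metric_deformation (direct_sum mu1 mu1) \<phi>)"
  using metric_deformation_trivial unfolding metric_deformation_def by blast

end
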